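(* Let $M,K\ge1$ be integers, let $P>0$, and for $k\in\mathcal K=\{1,\dots,K\}$ let $\beta_k>0$, $\sigma_k^2>0$ and let $\mathbf g_k\in\mathbb C^{M\times1}$ be the unit-norm array response vectors described in the context. For positive semidefinite Hermitian matrices $\mathbf Q_1,\dots,\mathbf Q_K\in\mathbb C^{M\times M}$ define $$\mathcal I_k^{\mathrm{ub}}=\log\left(1+\frac{\mathbf g_k^H\mathbf Q_k\mathbf g_k\,\beta_k}{\sum_{i\ne k}\mathbf g_k^H\mathbf Q_i\mathbf g_k\,\beta_k+\sigma_k^2}\right).$$ Consider the optimization problem $$\mathcal P^{\mathrm{ub}}:\quad\max_{\{\mathbf Q_k\}_{k=1}^K}\ \sum_{k=1}^K\mathcal I_k^{\mathrm{ub}}\quad\text{s.t.}\quad\sum_{k=1}^K\mathrm{tr}(\mathbf Q_k)\le P,\quad\mathbf Q_k\succeq\mathbf 0\ \ \forall k\in\mathcal K.$$ Then every optimal solution $\{\mathbf Q_k\}_{k=1}^K$ of $\mathcal P^{\mathrm{ub}}$ satisfies $\mathrm{rank}(\mathbf Q_k)\le1$ for all $k\in\mathcal K$.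
   Context: $(\cdot)^H$ is conjugate transpose and $\otimes$ is the Kronecker product. For a positive integer $n$ and antenna spacing $d>0$, with carrier wavelength $\lambda_c>0$, put $\mathbf a_n(x)=\frac1{\sqrt n}\big(1,e^{-j\frac{2\pi d}{\lambda_c}x},\dots,e^{-j\frac{2\pi d}{\lambda_c}(n-1)x}\big)^T$ (the spacing $d$ may be different along each array axis). The transmitter has a uniform planar array with $M=M_{\mathrm x}M_{\mathrm y}$ elements, and for user $k$ with angles $(\theta_k^{\mathrm x},\theta_k^{\mathrm y})$ the array response vector is $\mathbf g_k=\mathbf a_{M_{\mathrm x}}(\sin\theta_k^{\mathrm y}\cos\theta_k^{\mathrm x})\otimes\mathbf a_{M_{\mathrm y}}(\cos\theta_k^{\mathrm y})$, which has unit Euclidean norm. The constants $\beta_k$ (average channel power) and $\sigma_k^2$ (noise variance) are positive reals. *)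

theory Defs
  imports
    Complex_Main
    "Jordan_Normal_Form.Schur_Decomposition"
    "Jordan_Normal_Form.DL_Rank"
begin

(* The response of an n-element uniform linear array with spacing d, at carrier wavelength lc. *)
definition ula_response :: "real \<Rightarrow> real \<Rightarrow> nat \<Rightarrow> real \<Rightarrow> complex vec" where
  "ula_response lc d n x =
     vec n (\<lambda>i. complex_of_real (1 / sqrt (real n)) *
       exp (- (\<i> * complex_of_real (2 * pi * d / lc * real i * x))))"

definition kronecker_vec :: "complex vec \<Rightarrow> complex vec \<Rightarrow> complex vec" where
  "kronecker_vec u v =
     vec (dim_vec u * dim_vec v) (\<lambda>i. u $ (i div dim_vec v) * v $ (i mod dim_vec v))"

definition upa_response ::
  "real \<Rightarrow> real \<Rightarrow> real \<Rightarrow> nat \<Rightarrow> nat \<Rightarrow> real \<Rightarrow> real \<Rightarrow> complex vec" where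
  "upa_response lc dx dy Mx My \<theta>x \<theta>y =
     kronecker_vec (ula_response lc dx Mx (sin \<theta>y * cos \<theta>x)) (ula_response lc dy My (cos \<theta>y))"

definition mat_trace :: "complex mat \<Rightarrow> complex" where
  "mat_trace A = (\<Sum>i<dim_row A. A $$ (i, i))"

(* v\<^sup>H A v. Where A is Hermitian this is real, so taking the real part loses nothing;
   the same applies to the trace in ub_feasible. *)
definition quad_form :: "complex mat \<Rightarrow> complex vec \<Rightarrow> real" where
  "quad_form A v = Re ((A *\<^sub>v v) \<bullet>c v)"

definition psd_mat :: "nat \<Rightarrow> complex mat \<Rightarrow> bool" where
  "psd_mat n A \<longleftrightarrow> A \<in> carrier_mat n n \<and> mat_adjoint A = A \<and>
     (\<forall>v \<in> carrier_vec n. 0 \<le> quad_form A v)"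

(* Users are indexed by 1..K; values of the families outside this range play no role.
   The noise variance of user k is (\<sigma> k)\<^sup>2. *)
definition rate_ub ::
  "nat \<Rightarrow> (nat \<Rightarrow> complex vec) \<Rightarrow> (nat \<Rightarrow> real) \<Rightarrow> (nat \<Rightarrow> real) \<Rightarrow>
   (nat \<Rightarrow> complex mat) \<Rightarrow> nat \<Rightarrow> real" where
  "rate_ub K g \<beta> \<sigma> Q k =
     ln (1 + quad_form (Q k) (g k) * \<beta> k /
       ((\<Sum>i\<in>{1..K} - {k}. quad_form (Q i) (g k) * \<beta> k) + (\<sigma> k)\<^sup>2))"

definition sum_rate_ub ::
  "nat \<Rightarrow> (nat \<Rightarrow> complex vec) \<Rightarrow> (nat \<Rightarrow> real) \<Rightarrow> (nat \<Rightarrow> real) \<Rightarrow>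
   (nat \<Rightarrow> complex mat) \<Rightarrow> real" where
  "sum_rate_ub K g \<beta> \<sigma> Q = (\<Sum>k=1..K. rate_ub K g \<beta> \<sigma> Q k)"

definition ub_feasible :: "nat \<Rightarrow> nat \<Rightarrow> real \<Rightarrow> (nat \<Rightarrow> complex mat) \<Rightarrow> bool" where
  "ub_feasible M K P Q \<longleftrightarrow>
     (\<forall>k\<in>{1..K}. psd_mat M (Q k)) \<and> (\<Sum>k=1..K. Re (mat_trace (Q k))) \<le> P"

definition ub_optimal ::
  "nat \<Rightarrow> nat \<Rightarrow> real \<Rightarrow> (nat \<Rightarrow> complex vec) \<Rightarrow> (nat \<Rightarrow> real) \<Rightarrow> (nat \<Rightarrow> real) \<Rightarrow>
   (nat \<Rightarrow> complex mat) \<Rightarrow> bool" where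
  "ub_optimal M K P g \<beta> \<sigma> Q \<longleftrightarrow> ub_feasible M K P Q \<and>
     (\<forall>Q'. ub_feasible M K P Q' \<longrightarrow> sum_rate_ub K g \<beta> \<sigma> Q' \<le> sum_rate_ub K g \<beta> \<sigma> Q)"

end

theory Submission
  imports Defs
begin

text \<open>
  Let \<open>s = g\<^sup>H Q g\<close> for the matrix \<open>Q\<close> and channel \<open>g\<close> of one user in an optimal solution.
  Replace \<open>Q\<close> by the rank-one matrix \<open>w w\<^sup>H / s\<close> with \<open>w = Q g\<close>. This keeps the user's own signal
  power \<open>s\<close>, and by Cauchy--Schwarz for the form \<open>Q\<close> it is dominated by \<open>Q\<close>, so no user sees more
  interference and no rate drops. If the trace dropped, the spare power could be spent on scaling
  all matrices by a factor larger than one; this raises every nonzero rate because the noise does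
  not scale, contradicting optimality. Hence the positive semidefinite difference
  \<open>Q - w w\<^sup>H / s\<close> has trace zero and vanishes.
\<close>

section \<open>Algebra of the quadratic form, the trace and the adjoint\<close>

lemma quad_form_minus:
  assumes "A \<in> carrier_mat n n" "B \<in> carrier_mat n n" "v \<in> carrier_vec n"
  shows "quad_form (A - B) v = quad_form A v - quad_form B v"
  using assms unfolding quad_form_def
  by (simp add: minus_mult_distrib_mat_vec minus_scalar_prod_distrib[of _ n])

lemma quad_form_smult:
  assumes "A \<in> carrier_mat n n" "v \<in> carrier_vec n"
  shows "quad_form (complex_of_real t \<cdot>\<^sub>m A) v = t * quad_form A v"
proof -
  have "(complex_of_real t \<cdot>\<^sub>m A) *\<^sub>v v = complex_of_real t \<cdot>\<^sub>v (A *\<^sub>v v)"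
    using assms by (intro eq_vecI) auto
  then show ?thesis
    using assms by (simp add: quad_form_def)
qed

lemma mat_trace_minus:
  assumes "A \<in> carrier_mat n n" "B \<in> carrier_mat n n"
  shows "mat_trace (A - B) = mat_trace A - mat_trace B"
  using assms by (simp add: mat_trace_def sum_subtractf)

lemma mat_trace_smult:
  assumes "A \<in> carrier_mat n n"
  shows "mat_trace (c \<cdot>\<^sub>m A) = c * mat_trace A"
  using assms by (simp add: mat_trace_def sum_distrib_left)

lemma mat_adjoint_index:
  assumes "i < dim_col A" "j < dim_row A"
  shows "mat_adjoint A $$ (i, j) = conjugate (A $$ (j, i))"
  using assms by (simp add: mat_adjoint_def mat_of_rows_def)

text \<open>Turns self-adjointness into an entrywise condition, so that it passes to differences and
  real multiples by plain simplification.\<close>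

lemma mat_adjoint_eq_self_iff:
  assumes "A \<in> carrier_mat n n"
  shows "mat_adjoint A = A \<longleftrightarrow> (\<forall>i<n. \<forall>j<n. conjugate (A $$ (j, i)) = A $$ (i, j))"
proof -
  have "mat_adjoint A \<in> carrier_mat n n"
    using assms by (auto simp: mat_adjoint_def)
  then show ?thesis
    using assms mat_adjoint_index[of _ A] by (auto simp: mat_eq_iff)
qed

section \<open>Cauchy--Schwarz for positive semidefinite forms\<close>

lemma hermitian_form_swap:
  fixes A :: "complex mat"
  assumes A: "A \<in> carrier_mat n n" "mat_adjoint A = A"
    and uv: "u \<in> carrier_vec n" "v \<in> carrier_vec n"
  shows "(A *\<^sub>v u) \<bullet>c v = cnj ((A *\<^sub>v v) \<bullet>c u)"
proof -
  have h: "cnj (A $$ (j, i)) = A $$ (i, j)" if "i < n" "j < n" for i j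
    using mat_adjoint_eq_self_iff[OF A(1)] A(2) that by auto
  have e: "(A *\<^sub>v x) \<bullet>c y = (\<Sum>i<n. \<Sum>j<n. A $$ (i, j) * x $ j * cnj (y $ i))"
    if "x \<in> carrier_vec n" "y \<in> carrier_vec n" for x y
    using that A by (simp add: scalar_prod_def sum_distrib_right lessThan_atLeast0)
  show ?thesis
    unfolding e[OF uv] e[OF uv(2,1)]
    by (subst sum.swap) (auto simp: h intro!: sum.cong)
qed

text \<open>By conjugate symmetry the two cross terms of the expansion are conjugates of each other
  and merge into twice a real part.\<close>

lemma quad_form_add_smult:
  assumes A: "A \<in> carrier_mat n n" "mat_adjoint A = A"
    and uv: "u \<in> carrier_vec n" "v \<in> carrier_vec n"
  shows "quad_form A (v + t \<cdot>\<^sub>v u) =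
    quad_form A v + 2 * Re (cnj t * ((A *\<^sub>v v) \<bullet>c u)) + (cmod t)\<^sup>2 * quad_form A u"
proof -
  have "(A *\<^sub>v (v + t \<cdot>\<^sub>v u)) \<bullet>c (v + t \<cdot>\<^sub>v u) =
      (A *\<^sub>v v) \<bullet>c v + cnj t * ((A *\<^sub>v v) \<bullet>c u) + t * ((A *\<^sub>v u) \<bullet>c v)
        + t * cnj t * ((A *\<^sub>v u) \<bullet>c u)"
    using A uv
    by (simp add: mult_add_distrib_mat_vec mult_mat_vec conjugate_add_vec[of _ n] conjugate_smult_vec
        add_scalar_prod_distrib[of _ n] scalar_prod_add_distrib[of _ n] algebra_simps)
  also have "(A *\<^sub>v u) \<bullet>c v = cnj ((A *\<^sub>v v) \<bullet>c u)"
    by (rule hermitian_form_swap[OF A uv])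
  finally show ?thesis
    unfolding quad_form_def complex_norm_square[symmetric] by (simp add: algebra_simps)
qed

text \<open>The form stays nonnegative along the complex line through \<open>v\<close> in direction
  \<open>u\<close>; evaluating it at its minimum on that line gives the bound. Dividing by the form
  at \<open>u\<close> is possible by \<open>pos\<close>.\<close>

lemma psd_cauchy_schwarz:
  assumes A: "psd_mat n A" and uv: "u \<in> carrier_vec n" "v \<in> carrier_vec n"
    and pos: "quad_form A u > 0"
  shows "(cmod ((A *\<^sub>v v) \<bullet>c u))\<^sup>2 \<le> quad_form A u * quad_form A v"
proof -
  let ?z = "(A *\<^sub>v v) \<bullet>c u" and ?q = "quad_form A u"
  \<comment> \<open>The minimiser found by completing the square in the expansion of
    \<open>quad_form A (v + t u)\<close>.\<close>
  let ?t = "- ?z / complex_of_real ?q"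
  have A': "A \<in> carrier_mat n n" "mat_adjoint A = A"
    and nn: "\<And>x. x \<in> carrier_vec n \<Longrightarrow> 0 \<le> quad_form A x"
    using A by (auto simp: psd_mat_def)
  have "0 \<le> quad_form A (v + ?t \<cdot>\<^sub>v u)"
    using uv by (intro nn) auto
  also have "\<dots> = quad_form A v + 2 * Re (cnj ?t * ?z) + (cmod ?t)\<^sup>2 * ?q"
    by (rule quad_form_add_smult[OF A' uv])
  also have "Re (cnj ?t * ?z) = - ((cmod ?z)\<^sup>2 / ?q)"
    unfolding cmod_power2 by (simp add: power2_eq_square add_divide_distrib)
  also have "(cmod ?t)\<^sup>2 * ?q = (cmod ?z)\<^sup>2 / ?q"
    using pos by (simp add: norm_divide power_divide power2_eq_square)
  finally have "(cmod ?z)\<^sup>2 / ?q \<le> quad_form A v"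
    by simp
  then show ?thesis
    using pos by (simp add: field_simps)
qed

section \<open>Diagonal and trace of positive semidefinite matrices\<close>

lemma mult_mat_unit_vec_cscalar:
  fixes A :: "complex mat"
  assumes "A \<in> carrier_mat n n" "i < n" "j < n"
  shows "(A *\<^sub>v unit_vec n j) \<bullet>c unit_vec n i = A $$ (i, j)"
proof -
  have "conjugate (unit_vec n i) = (unit_vec n i :: complex vec)"
    by (auto simp: unit_vec_def)
  then show ?thesis
    using assms by simp
qed

lemma psd_diag:
  assumes "psd_mat n A" "i < n"
  shows "quad_form A (unit_vec n i) = Re (A $$ (i, i))" "0 \<le> Re (A $$ (i, i))"
proof -
  show *: "quad_form A (unit_vec n i) = Re (A $$ (i, i))"
    using assms by (simp add: quad_form_def mult_mat_unit_vec_cscalar psd_mat_def)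
  have "0 \<le> quad_form A (unit_vec n i)"
    using assms by (simp add: psd_mat_def)
  then show "0 \<le> Re (A $$ (i, i))" by (simp add: *)
qed

lemma psd_trace_nonneg:
  assumes "psd_mat n A"
  shows "0 \<le> Re (mat_trace A)"
  using assms psd_diag(2)[OF assms] by (auto simp: mat_trace_def psd_mat_def intro!: sum_nonneg)

text \<open>The diagonal entries are nonnegative with sum zero, so each vanishes. On the span of two
  unit vectors only the cross term of the form is then left, and it would take negative values
  unless the off-diagonal entry is zero.\<close>

lemma psd_trace_zero:
  assumes A: "psd_mat n A" and tr: "Re (mat_trace A) = 0"
  shows "A = 0\<^sub>m n n"
proof -
  have A': "A \<in> carrier_mat n n" "mat_adjoint A = A"
    using A by (auto simp: psd_mat_def)
  have "(\<Sum>i<n. Re (A $$ (i, i))) = 0"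
    using tr A' by (simp add: mat_trace_def)
  then have d: "quad_form A (unit_vec n i) = 0" if "i < n" for i
    using that psd_diag[OF A] by (subst (asm) sum_nonneg_eq_0_iff) auto
  have "A $$ (i, j) = 0" if ij: "i < n" "j < n" for i j
  proof -
    \<comment> \<open>This choice makes the remaining cross term equal to
      \<open>-2 |A_ij|^2\<close>.\<close>
    let ?t = "- A $$ (i, j)"
    have "0 \<le> quad_form A (unit_vec n j + ?t \<cdot>\<^sub>v unit_vec n i)"
      using A by (auto simp: psd_mat_def)
    also have "\<dots> = - 2 * (cmod (A $$ (i, j)))\<^sup>2"
      using ij quad_form_add_smult[OF A', of "unit_vec n i" "unit_vec n j" ?t]
      unfolding cmod_power2
      by (simp add: d mult_mat_unit_vec_cscalar[OF A'(1)] power2_eq_square)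
    finally have "(cmod (A $$ (i, j)))\<^sup>2 \<le> 0" by simp
    then show ?thesis by simp
  qed
  then show ?thesis
    using A' by auto
qed

section \<open>Rank-one matrices and the compression of a form to one channel\<close>

definition scaled_outer :: "real \<Rightarrow> complex vec \<Rightarrow> complex mat" where
  "scaled_outer s w =
     mat (dim_vec w) (dim_vec w) (\<lambda>(i, j). w $ i * cnj (w $ j) / complex_of_real s)"

lemma scaled_outer_carrier [simp]:
  "w \<in> carrier_vec n \<Longrightarrow> scaled_outer s w \<in> carrier_mat n n"
  by (auto simp: scaled_outer_def)

lemma scaled_outer_mult:
  assumes "w \<in> carrier_vec n" "v \<in> carrier_vec n"
  shows "scaled_outer s w *\<^sub>v v = (v \<bullet>c w / complex_of_real s) \<cdot>\<^sub>v w"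
  using assms
  by (auto simp: scaled_outer_def scalar_prod_def sum_distrib_left sum_distrib_right
      sum_divide_distrib mult_ac intro!: sum.cong eq_vecI)

lemma quad_form_scaled_outer:
  assumes "w \<in> carrier_vec n" "v \<in> carrier_vec n"
  shows "quad_form (scaled_outer s w) v = (cmod (w \<bullet>c v))\<^sup>2 / s"
proof -
  have "v \<bullet>c w = cnj (w \<bullet>c v)"
    using assms conjugate_conjugate_sprod[of w n v] conjugate_vec_sprod_comm[of v n w]
    by (metis conjugate_complex_def conjugate_id)
  then show ?thesis
    using assms
    unfolding cmod_power2
    by (simp add: quad_form_def scaled_outer_mult power2_eq_square add_divide_distrib)
qed

lemma mat_adjoint_scaled_outer:
  "mat_adjoint (scaled_outer s w) = scaled_outer s w"
  by (subst mat_adjoint_eq_self_iff[of _ "dim_vec w"]) (auto simp: scaled_outer_def)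

lemma psd_scaled_outer:
  assumes "w \<in> carrier_vec n" "0 \<le> s"
  shows "psd_mat n (scaled_outer s w)"
  using assms by (simp add: psd_mat_def mat_adjoint_scaled_outer quad_form_scaled_outer)

lemma rank_scaled_outer:
  assumes "w \<in> carrier_vec n"
  shows "vec_space.rank n (scaled_outer s w) \<le> 1"
  using assms
  by (intro vec_space.rank_le_1_product_entries[where f = "\<lambda>i. w $ i"
        and g = "\<lambda>j. cnj (w $ j) / complex_of_real s"])
    (auto simp: scaled_outer_def)

text \<open>For \<open>g\<^sup>H A g = 0\<close> the division by zero makes the compression the zero matrix, which is
  the intended value.\<close>
definition compression :: "complex mat \<Rightarrow> complex vec \<Rightarrow> complex mat" where
  "compression A g = scaled_outer (quad_form A g) (A *\<^sub>v g)"

text \<open>The left side is \<open>|g^H A g|^2 / s\<close> with \<open>s = quad_form A g\<close>.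
  As \<open>A\<close> is Hermitian, \<open>g^H A g\<close> is real and equals \<open>s\<close>, so
  the quotient is \<open>s\<close>, also when \<open>s = 0\<close>.\<close>

lemma quad_form_compression:
  assumes A: "psd_mat n A" and g: "g \<in> carrier_vec n"
  shows "quad_form (compression A g) g = quad_form A g"
proof -
  have A': "A \<in> carrier_mat n n" "mat_adjoint A = A"
    using A by (auto simp: psd_mat_def)
  have w: "A *\<^sub>v g \<in> carrier_vec n"
    using A' g by auto
  have "Im ((A *\<^sub>v g) \<bullet>c g) = 0"
    using arg_cong[OF hermitian_form_swap[OF A' g g], of Im] by simp
  then have "(cmod ((A *\<^sub>v g) \<bullet>c g))\<^sup>2 = (quad_form A g)\<^sup>2"
    by (simp add: quad_form_def cmod_power2)
  then show ?thesis
    by (simp add: compression_def quad_form_scaled_outer[OF w g] power2_eq_square)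
qed

text \<open>At \<open>v\<close> the form of the compression is \<open>|v^H A g|^2 / s\<close>, which
  Cauchy--Schwarz bounds by the form of \<open>A\<close> at \<open>v\<close>. If
  \<open>s = 0\<close>, the compression contributes nothing.\<close>

lemma psd_minus_compression:
  assumes A: "psd_mat n A" and g: "g \<in> carrier_vec n"
  shows "psd_mat n (A - compression A g)"
proof -
  have A': "A \<in> carrier_mat n n" "mat_adjoint A = A" and nn: "0 \<le> quad_form A g"
    using A g by (auto simp: psd_mat_def)
  have w: "A *\<^sub>v g \<in> carrier_vec n"
    using A' g by auto
  have B: "compression A g \<in> carrier_mat n n"
    "mat_adjoint (compression A g) = compression A g"
    using w by (simp_all add: compression_def mat_adjoint_scaled_outer)
  have D: "A - compression A g \<in> carrier_mat n n"
    using B by auto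
  have "mat_adjoint (A - compression A g) = A - compression A g"
    using A' B unfolding mat_adjoint_eq_self_iff[OF D] mat_adjoint_eq_self_iff[OF A'(1)]
      mat_adjoint_eq_self_iff[OF B(1)] by auto
  moreover have "0 \<le> quad_form (A - compression A g) v" if v: "v \<in> carrier_vec n" for v
  proof (cases "quad_form A g = 0")
    case True
    have "0 \<le> quad_form A v"
      using A v by (auto simp: psd_mat_def)
    then show ?thesis
      unfolding quad_form_minus[OF A'(1) B(1) v]
      by (simp add: compression_def quad_form_scaled_outer[OF w v] True)
  next
    case False
    then have pos: "quad_form A g > 0" using nn by simp
    have "(cmod ((A *\<^sub>v g) \<bullet>c v))\<^sup>2 \<le> quad_form A g * quad_form A v"
      using psd_cauchy_schwarz[OF A g v pos] hermitian_form_swap[OF A' g v] by simp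
    then show ?thesis
      unfolding quad_form_minus[OF A'(1) B(1) v]
      using pos by (simp add: compression_def quad_form_scaled_outer[OF w v] field_simps)
  qed
  ultimately show ?thesis
    using D by (simp add: psd_mat_def)
qed

lemma psd_compression:
  assumes "psd_mat n A" "g \<in> carrier_vec n"
  shows "psd_mat n (compression A g)"
  unfolding compression_def using assms
  by (intro psd_scaled_outer) (auto simp: psd_mat_def)

section \<open>Scaling, identity and zero in the positive semidefinite cone\<close>

lemma psd_smult:
  assumes "psd_mat n A" "0 \<le> t"
  shows "psd_mat n (complex_of_real t \<cdot>\<^sub>m A)"
proof -
  have A: "A \<in> carrier_mat n n" "mat_adjoint A = A"
    using assms by (auto simp: psd_mat_def)
  have tA: "complex_of_real t \<cdot>\<^sub>m A \<in> carrier_mat n n"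
    using A by simp
  have "mat_adjoint (complex_of_real t \<cdot>\<^sub>m A) = complex_of_real t \<cdot>\<^sub>m A"
    using A unfolding mat_adjoint_eq_self_iff[OF A(1)] mat_adjoint_eq_self_iff[OF tA] by auto
  then show ?thesis
    using assms A tA by (auto simp: psd_mat_def quad_form_smult)
qed

lemma quad_form_one: "v \<in> carrier_vec n \<Longrightarrow> quad_form (1\<^sub>m n) v = Re (v \<bullet>c v)"
  by (simp add: quad_form_def)

lemma quad_form_one_pos:
  assumes "v \<in> carrier_vec n" "v \<noteq> 0\<^sub>v n"
  shows "quad_form (1\<^sub>m n) v > 0"
  using assms conjugate_square_greater_0_vec[OF assms(1)]
  by (simp add: quad_form_one less_complex_def)

lemma psd_one: "psd_mat n (1\<^sub>m n)"
proof -
  have "mat_adjoint (1\<^sub>m n) = (1\<^sub>m n :: complex mat)"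
    by (subst mat_adjoint_eq_self_iff[of _ n]) auto
  moreover have "0 \<le> quad_form (1\<^sub>m n) v" if "v \<in> carrier_vec n" for v
    using that conjugate_square_ge_0_vec[of v] by (simp add: quad_form_one less_eq_complex_def)
  ultimately show ?thesis
    by (simp add: psd_mat_def)
qed

lemma psd_zero: "psd_mat n (0\<^sub>m n n)"
proof -
  have "complex_of_real 0 \<cdot>\<^sub>m 1\<^sub>m n = 0\<^sub>m n n"
    by auto
  then show ?thesis
    using psd_smult[OF psd_one, of 0 n] by simp
qed

section \<open>The sum rate for arbitrary nonzero channel vectors\<close>

locale downlink =
  fixes K n :: nat and P :: real and g :: "nat \<Rightarrow> complex vec" and \<beta> \<sigma> :: "nat \<Rightarrow> real"
  assumes K: "K \<ge> 1" and P: "P > 0"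
    and \<beta>: "\<And>k. k \<in> {1..K} \<Longrightarrow> \<beta> k > 0"
    and \<sigma>: "\<And>k. k \<in> {1..K} \<Longrightarrow> (\<sigma> k)\<^sup>2 > 0"
    and g: "\<And>k. k \<in> {1..K} \<Longrightarrow> g k \<in> carrier_vec n"
    and g_nonzero: "\<And>k. k \<in> {1..K} \<Longrightarrow> g k \<noteq> 0\<^sub>v n"
begin

abbreviation feasible where "feasible \<equiv> ub_feasible n K P"
abbreviation sum_rate where "sum_rate \<equiv> sum_rate_ub K g \<beta> \<sigma>"

definition signal where "signal Q k = quad_form (Q k) (g k) * \<beta> k"
definition interference where
  "interference Q k = (\<Sum>i\<in>{1..K} - {k}. quad_form (Q i) (g k) * \<beta> k)"

lemma rate_eq: "rate_ub K g \<beta> \<sigma> Q k = ln (1 + signal Q k / (interference Q k + (\<sigma> k)\<^sup>2))"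
  by (simp add: rate_ub_def signal_def interference_def)

lemma
  assumes "\<forall>i\<in>{1..K}. psd_mat n (Q i)" "k \<in> {1..K}"
  shows signal_nonneg: "0 \<le> signal Q k" and interference_nonneg: "0 \<le> interference Q k"
proof -
  have "0 \<le> quad_form (Q i) (g k) * \<beta> k" if "i \<in> {1..K}" for i
    using that assms g \<beta>[OF assms(2)] by (auto simp: psd_mat_def)
  then show "0 \<le> signal Q k" "0 \<le> interference Q k"
    using assms(2) by (auto simp: signal_def interference_def intro!: sum_nonneg)
qed

text \<open>Every rate is \<open>ln (1 + x)\<close> with \<open>x\<close> nonnegative, and it
  vanishes only at \<open>x = 0\<close>; the noise keeps the denominators positive. The lemma
  supplies the user with positive signal on which the strict gain from scaling rests.\<close>

lemma sum_rate_pos_iff: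
  assumes psd: "\<forall>i\<in>{1..K}. psd_mat n (Q i)"
  shows "sum_rate Q > 0 \<longleftrightarrow> (\<exists>k\<in>{1..K}. signal Q k > 0)"
proof -
  have nn: "0 \<le> rate_ub K g \<beta> \<sigma> Q k" and iff: "rate_ub K g \<beta> \<sigma> Q k = 0 \<longleftrightarrow> signal Q k = 0"
    if k: "k \<in> {1..K}" for k
  proof -
    let ?x = "signal Q k / (interference Q k + (\<sigma> k)\<^sup>2)"
    have d: "interference Q k + (\<sigma> k)\<^sup>2 > 0"
      using interference_nonneg[OF psd k] \<sigma>[OF k] by (rule add_nonneg_pos)
    have x: "0 \<le> ?x"
      using signal_nonneg[OF psd k] d by simp
    then show "0 \<le> rate_ub K g \<beta> \<sigma> Q k"
      by (simp add: rate_eq)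
    have "rate_ub K g \<beta> \<sigma> Q k = 0 \<longleftrightarrow> ?x = 0"
      unfolding rate_eq using x by (subst ln_eq_zero_iff) auto
    then show "rate_ub K g \<beta> \<sigma> Q k = 0 \<longleftrightarrow> signal Q k = 0"
      using d by auto
  qed
  have "sum_rate Q \<ge> 0"
    unfolding sum_rate_ub_def using nn by (rule sum_nonneg)
  moreover have "sum_rate Q = 0 \<longleftrightarrow> (\<forall>k\<in>{1..K}. signal Q k = 0)"
    unfolding sum_rate_ub_def using nn iff by (subst sum_nonneg_eq_0_iff) auto
  ultimately show ?thesis
    using signal_nonneg[OF psd] by (metis less_eq_real_def order_less_irrefl)
qed

text \<open>Signal and interference both grow by the factor \<open>t\<close> while the noise stays
  fixed, so each signal-to-interference-plus-noise ratio grows, and strictly so wherever the signal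
  is positive.\<close>

lemma sum_rate_scale:
  assumes psd: "\<forall>i\<in>{1..K}. psd_mat n (Q i)" and t: "t > 1"
    and pos: "\<exists>k\<in>{1..K}. signal Q k > 0"
  shows "sum_rate Q < sum_rate (\<lambda>i. complex_of_real t \<cdot>\<^sub>m Q i)"
proof -
  let ?R = "\<lambda>i. complex_of_real t \<cdot>\<^sub>m Q i"
  have q: "quad_form (?R i) (g k) = t * quad_form (Q i) (g k)" if "i \<in> {1..K}" "k \<in> {1..K}" for i k
    using that psd g by (auto simp: psd_mat_def intro!: quad_form_smult)
  have S: "signal ?R k = t * signal Q k" if "k \<in> {1..K}" for k
    using that by (simp add: signal_def q)
  have I: "interference ?R k = t * interference Q k" if "k \<in> {1..K}" for k
    using that by (simp add: interference_def q sum_distrib_left mult.assoc)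
  have le: "rate_ub K g \<beta> \<sigma> Q k \<le> rate_ub K g \<beta> \<sigma> ?R k"
    and less: "signal Q k > 0 \<Longrightarrow> rate_ub K g \<beta> \<sigma> Q k < rate_ub K g \<beta> \<sigma> ?R k"
    if k: "k \<in> {1..K}" for k
  proof -
    define s i v where "s = signal Q k" and "i = interference Q k" and "v = (\<sigma> k)\<^sup>2"
    have nn: "0 \<le> s" "0 \<le> i" "0 < v"
      using signal_nonneg[OF psd k] interference_nonneg[OF psd k] \<sigma>[OF k]
      by (simp_all add: s_def i_def v_def)
    have d: "0 < i + v" "0 < t * i + v"
      using nn t by (auto intro!: add_nonneg_pos)
    \<comment> \<open>Over a common denominator the interference terms cancel, leaving a gain whose
      sign can be read off from \<open>t > 1\<close>.\<close>
    have e: "t * s / (t * i + v) - s / (i + v) = s * v * (t - 1) / ((t * i + v) * (i + v))"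
      using d by (simp add: field_simps)
    have pos: "0 < s / (i + v) + 1"
      using nn d by (intro add_nonneg_pos) auto
    have "0 \<le> s * v * (t - 1) / ((t * i + v) * (i + v))"
      using nn d t by (intro divide_nonneg_nonneg mult_nonneg_nonneg) auto
    then show "rate_ub K g \<beta> \<sigma> Q k \<le> rate_ub K g \<beta> \<sigma> ?R k"
      unfolding rate_eq S[OF k] I[OF k] s_def[symmetric] i_def[symmetric] v_def[symmetric]
      using pos e by (intro ln_mono) auto
    assume "signal Q k > 0"
    then have "0 < s * v * (t - 1) / ((t * i + v) * (i + v))"
      using nn d t by (intro divide_pos_pos mult_pos_pos) (auto simp: s_def)
    then show "rate_ub K g \<beta> \<sigma> Q k < rate_ub K g \<beta> \<sigma> ?R k"
      unfolding rate_eq S[OF k] I[OF k] s_def[symmetric] i_def[symmetric] v_def[symmetric]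
      using pos e by (intro ln_less_cancel_iff[THEN iffD2]) auto
  qed
  show ?thesis
    unfolding sum_rate_ub_def using le less pos
    by (intro sum_strict_mono_ex1) (simp_all, metis atLeastAtMost_iff)
qed

text \<open>Compression along a user's own channel preserves that user's signal, and by domination
  it can only reduce the interference caused at the other users.\<close>

lemma sum_rate_compress:
  assumes psd: "\<forall>i\<in>{1..K}. psd_mat n (Q i)" and k: "k \<in> {1..K}"
  defines "Q' \<equiv> Q(k := compression (Q k) (g k))"
  shows "sum_rate Q \<le> sum_rate Q'" and "\<And>i. i \<in> {1..K} \<Longrightarrow> signal Q' i = signal Q i"
proof -
  have psd': "\<forall>i\<in>{1..K}. psd_mat n (Q' i)"
    using psd k g by (simp add: Q'_def psd_compression)
  have dom: "quad_form (Q' i) (g j) \<le> quad_form (Q i) (g j)"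
    if ij: "i \<in> {1..K}" "j \<in> {1..K}" for i j
  proof (cases "i = k")
    case True
    have "0 \<le> quad_form (Q k - compression (Q k) (g k)) (g j)"
      using psd_minus_compression[of n "Q k" "g k"] psd k g ij by (auto simp: psd_mat_def)
    moreover have "Q k \<in> carrier_mat n n" "compression (Q k) (g k) \<in> carrier_mat n n"
      using psd psd_compression[of n "Q k" "g k"] k g by (auto simp: psd_mat_def)
    ultimately show ?thesis
      using True g[OF ij(2)] by (simp add: Q'_def quad_form_minus)
  qed (simp add: Q'_def)
  show sig: "signal Q' i = signal Q i" if "i \<in> {1..K}" for i
    using that psd g by (auto simp: signal_def Q'_def quad_form_compression[of n])
  have int: "interference Q' i \<le> interference Q i" if "i \<in> {1..K}" for i
    unfolding interference_def using that dom \<beta>[OF that]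
    by (intro sum_mono mult_right_mono) auto
  show "sum_rate Q \<le> sum_rate Q'"
    unfolding sum_rate_ub_def
  proof (rule sum_mono)
    fix i assume i: "i \<in> {1..K}"
    have "signal Q i / (interference Q i + (\<sigma> i)\<^sup>2) \<le> signal Q i / (interference Q' i + (\<sigma> i)\<^sup>2)"
      using signal_nonneg[OF psd i] interference_nonneg[OF psd' i] int[OF i] \<sigma>[OF i]
      by (intro divide_left_mono) (auto intro!: mult_pos_pos add_nonneg_pos)
    moreover have "0 \<le> signal Q i / (interference Q i + (\<sigma> i)\<^sup>2)"
      using signal_nonneg[OF psd i] interference_nonneg[OF psd i] by simp
    ultimately show "rate_ub K g \<beta> \<sigma> Q i \<le> rate_ub K g \<beta> \<sigma> Q' i"
      unfolding rate_eq sig[OF i] by (intro ln_mono) auto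
  qed
qed

section \<open>Optimal solutions: positive value, full power, rank\<close>

lemma optimal_pos:
  assumes "ub_optimal n K P g \<beta> \<sigma> Q"
  shows "sum_rate Q > 0"
proof -
  have K1: "(1::nat) \<in> {1..K}" using K by simp
  \<comment> \<open>In dimension zero the only vector is the zero vector, which a channel is
    not.\<close>
  have n: "n > 0"
    using g[OF K1] g_nonzero[OF K1] by (intro gr0I) auto
  \<comment> \<open>A feasible competitor: user 1 radiates the whole budget isotropically, and
    \<open>P / n\<close> normalises the trace to \<open>P\<close>. Its signal is positive because
    the channel of user 1 is nonzero.\<close>
  define R where "R i = (if i = 1 then complex_of_real (P / n) \<cdot>\<^sub>m 1\<^sub>m n else 0\<^sub>m n n)" for i :: nat
  have psd: "\<forall>i\<in>{1..K}. psd_mat n (R i)"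
    using P by (auto simp: R_def simp del: of_real_divide intro!: psd_smult psd_one psd_zero)
  have "Re (mat_trace (R i)) = (if i = 1 then P else 0)" for i
    using n by (auto simp: R_def mat_trace_def)
  then have "feasible R"
    using psd K1 by (simp add: ub_feasible_def)
  moreover have "signal R 1 > 0"
    using quad_form_one_pos[OF g[OF K1] g_nonzero[OF K1]] n P \<beta>[OF K1] g[OF K1]
    by (simp add: signal_def R_def quad_form_smult[OF one_carrier_mat] del: of_real_divide)
  then have "sum_rate R > 0"
    using K1 sum_rate_pos_iff[OF psd] by blast
  ultimately show ?thesis
    using assms by (force simp: ub_optimal_def)
qed

text \<open>Unspent power would allow a scaling that strictly beats the optimum. The claim concerns
  any feasible family that is no worse than \<open>Q\<close>, so that it applies to the compressed
  one.\<close>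

lemma optimal_full_power:
  assumes opt: "ub_optimal n K P g \<beta> \<sigma> Q" and Q': "feasible Q'" "sum_rate Q \<le> sum_rate Q'"
  shows "(\<Sum>k=1..K. Re (mat_trace (Q' k))) = P"
proof (rule ccontr)
  let ?T = "\<Sum>k=1..K. Re (mat_trace (Q' k))"
  assume "?T \<noteq> P"
  then have T: "?T < P" using Q' by (simp add: ub_feasible_def)
  have psd: "\<forall>i\<in>{1..K}. psd_mat n (Q' i)"
    using Q' by (simp add: ub_feasible_def)
  have T0: "0 \<le> ?T"
    using psd by (intro sum_nonneg psd_trace_nonneg) auto
  \<comment> \<open>The natural factor \<open>P / ?T\<close> is unusable at \<open>?T = 0\<close>.
    This one is always defined and above one, and the scaled power
    \<open>?T + (P - ?T) * ?T / (1 + ?T)\<close> stays within the budget.\<close>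
  define t where "t = 1 + (P - ?T) / (1 + ?T)"
  have t: "t > 1" using T T0 by (simp add: t_def)
  let ?R = "\<lambda>i. complex_of_real t \<cdot>\<^sub>m Q' i"
  have "Re (mat_trace (?R i)) = t * Re (mat_trace (Q' i))" if "i \<in> {1..K}" for i
    using that psd by (subst mat_trace_smult[of _ n]) (auto simp: psd_mat_def)
  then have "(\<Sum>k=1..K. Re (mat_trace (?R k))) = t * ?T"
    by (simp add: sum_distrib_left)
  also have "\<dots> = ?T + (P - ?T) * (?T / (1 + ?T))"
    by (simp add: t_def algebra_simps)
  also have "\<dots> \<le> ?T + (P - ?T) * 1"
    using T T0 by (intro add_left_mono mult_left_mono) auto
  finally have "feasible ?R"
    using psd t by (simp add: ub_feasible_def psd_smult)
  then have "sum_rate ?R \<le> sum_rate Q"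
    using opt by (simp add: ub_optimal_def)
  moreover have "sum_rate Q' > 0"
    using optimal_pos[OF opt] Q'(2) by simp
  then have "sum_rate Q' < sum_rate ?R"
    using sum_rate_scale[OF psd t] sum_rate_pos_iff[OF psd] by blast
  ultimately show False
    using Q'(2) by simp
qed

theorem optimal_rank_le_1:
  assumes opt: "ub_optimal n K P g \<beta> \<sigma> Q" and k: "k \<in> {1..K}"
  shows "vec_space.rank n (Q k) \<le> 1"
proof -
  let ?C = "compression (Q k) (g k)"
  let ?Q' = "Q(k := ?C)"
  have feas: "feasible Q" and psd: "\<forall>i\<in>{1..K}. psd_mat n (Q i)"
    using opt by (auto simp: ub_optimal_def ub_feasible_def)
  have C: "psd_mat n ?C" and D: "psd_mat n (Q k - ?C)"
    using psd k g by (auto intro: psd_compression psd_minus_compression)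
  have car: "Q k \<in> carrier_mat n n" "?C \<in> carrier_mat n n"
    using psd k C by (auto simp: psd_mat_def)
  have tr: "Re (mat_trace (Q k - ?C)) = Re (mat_trace (Q k)) - Re (mat_trace ?C)"
    by (simp add: mat_trace_minus[OF car])
  have sums: "(\<Sum>i=1..K. Re (mat_trace (?Q' i))) =
      (\<Sum>i=1..K. Re (mat_trace (Q i))) - Re (mat_trace (Q k - ?C))"
    using k by (simp add: sum.remove[of _ k] tr)
  have "feasible ?Q'"
    using feas psd C sums psd_trace_nonneg[OF D] by (simp add: ub_feasible_def)
  then have "(\<Sum>i=1..K. Re (mat_trace (?Q' i))) = P"
    using optimal_full_power[OF opt] sum_rate_compress(1)[OF psd k] by blast
  \<comment> \<open>The compressed family spends exactly \<open>P\<close>, which is the power of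
    \<open>Q\<close> minus this trace. As \<open>Q\<close> spends at most \<open>P\<close>, the
    nonnegative trace is also at most zero.\<close>
  then have "Re (mat_trace (Q k - ?C)) = 0"
    using sums feas psd_trace_nonneg[OF D] by (simp add: ub_feasible_def)
  then have "Q k - ?C = 0\<^sub>m n n"
    by (rule psd_trace_zero[OF D])
  then have "Q k = ?C"
    using car by (auto simp: mat_eq_iff)
  moreover have "vec_space.rank n ?C \<le> 1"
    unfolding compression_def using car(1) g[OF k] by (intro rank_scaled_outer) auto
  ultimately show ?thesis by simp
qed

end

section \<open>Array responses as nonzero channel vectors\<close>

lemma upa_response_carrier: "upa_response lc dx dy Mx My \<theta>x \<theta>y \<in> carrier_vec (Mx * My)"
  by (auto simp: upa_response_def kronecker_vec_def ula_response_def)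

text \<open>At index 0 both phases are \<open>exp 0 = 1\<close>, so the first entry is the product
  of the two positive normalising factors.\<close>

lemma upa_response_nonzero:
  assumes "Mx \<ge> 1" "My \<ge> 1"
  shows "upa_response lc dx dy Mx My \<theta>x \<theta>y \<noteq> 0\<^sub>v (Mx * My)"
proof
  assume "upa_response lc dx dy Mx My \<theta>x \<theta>y = 0\<^sub>v (Mx * My)"
  then have "upa_response lc dx dy Mx My \<theta>x \<theta>y $ 0 = 0"
    using assms by simp
  then show False
    using assms by (simp add: upa_response_def kronecker_vec_def ula_response_def)
qed

theorem theorem2:
  fixes M Mx My K :: nat and P lc dx dy :: real
    and \<theta>x \<theta>y \<beta> \<sigma> :: "nat \<Rightarrow> real"
    and g :: "nat \<Rightarrow> complex vec" and Q :: "nat \<Rightarrow> complex mat"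
  assumes "Mx \<ge> 1" and "My \<ge> 1" and "M = Mx * My" and "K \<ge> 1" and "P > 0"
    and "lc > 0" and "dx > 0" and "dy > 0"
    and "\<And>k. k \<in> {1..K} \<Longrightarrow> \<beta> k > 0"
    and "\<And>k. k \<in> {1..K} \<Longrightarrow> (\<sigma> k)\<^sup>2 > 0"
    and "\<And>k. k \<in> {1..K} \<Longrightarrow> g k = upa_response lc dx dy Mx My (\<theta>x k) (\<theta>y k)"
    and "ub_optimal M K P g \<beta> \<sigma> Q"
  shows "\<forall>k\<in>{1..K}. vec_space.rank M (Q k) \<le> 1"
proof -
  interpret downlink K M P g \<beta> \<sigma>
    using assms upa_response_carrier upa_response_nonzero by unfold_locales simp_all
  show ?thesis
    using optimal_rank_le_1[OF assms(12)] by blast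
qed

end
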